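(* Let $\Lambda$ be an episturmian language on three letters satisfying $(Rabc)$. Then $\Lambda$ contains infinitely many clustering words if and only if its directive word is $D'D''$, where $D'$ is a finite word on the alphabet $\{a,b\}$ and $D''$ is a one-sided infinite word on the alphabet $\{a,c\}$ or on the alphabet $\{b,c\}$. When this is not the case, let $\lambda_2$ be the stage of the first rule $(c)$, $\mu_a$ the stage of the first rule $(a)$ after $\lambda_2$, $\mu_b$ the stage of the first rule $(b)$ after $\lambda_2$, and let $x,y$ be the elements of $\{a,b\}$ such that $\mu_x<\mu_y$. Then no word of $\Lambda$ of length at least $$|w_{\lambda_2}|+\max\{|Z_{\mu_y+1}| : Z\in\{A,B,C\},\ w_{\mu_y+1}Z_{\mu_y+1}\in\Lambda\}+1$$ can cluster for any permutation and any order on $\{a,b,c\}$.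
   Context: Episturmian languages. A language (factorial, extendable set of words) is episturmian if it is uniformly recurrent (for every word $w$ of the language there is $K$ such that $w$ occurs in every word of the language of length at least $K$), closed under reversal, and admits at most one right special factor of each length (a word $w$ is right special if it has more than one right extension $wx$ in the language). The episturmian languages on the three letters $\{a,b,c\}$ are exactly those generated as follows. Given an infinite sequence of rules $(x_k)_{k\ge0}$, $x_k\in\{a,b,c\}$, in which each of $a,b,c$ occurs at least once, define words by $A_0=a$, $B_0=b$, $C_0=c$ and: by rule $(a)$ at stage $k$ (i.e. $x_k=a$), $A_{k+1}=A_k$, $B_{k+1}=B_kA_k$, $C_{k+1}=C_kA_k$; by rule $(b)$, $A_{k+1}=A_kB_k$, $B_{k+1}=B_k$, $C_{k+1}=C_kB_k$; by rule $(c)$, $A_{k+1}=A_kC_k$, $B_{k+1}=B_kC_k$, $C_{k+1}=C_k$. The language $\Lambda$ is the set of all factors of the words $A_k,B_k,C_k$, $k\ge0$; its directive word is $x_0x_1x_2\cdots$. The words $w_k$ are given by: $w_0$ is the empty word, and $w_{k+1}=w_kA_k$, $w_kB_k$ or $w_kC_k$ according to whether the rule at stage $k$ is $(a)$, $(b)$ or $(c)$. $(Rabc)$: the rule at stage $0$ is $(a)$ and the first rule different from $(a)$ is $(b)$. Clustering. For a total order on the alphabet, written $a_1<\dots<a_r$, the Burrows-Wheeler transform $B(w)$ of a word $w=w_1\cdots w_n$ is obtained by listing its $n$ cyclic conjugates $w_i\cdots w_nw_1\cdots w_{i-1}$ (with multiplicity) in nondecreasing lexicographical order and reading the sequence of their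 last letters. The word $w$ clusters for this order and a permutation $\pi\neq \mathrm{Id}$ of the alphabet if $B(w)=(\pi a_1)^{n_{\pi a_1}}\cdots(\pi a_r)^{n_{\pi a_r}}$, where $n_a\ge0$ is the number of occurrences of $a$ in $w$. A word is clustering if it clusters for some order on $\{a,b,c\}$ and some permutation $\pi\ne\mathrm{Id}$. *)

theory Defs
  imports
    "HOL-Library.Sublist"
    "HOL-Library.List_Lexorder"
    "HOL-Library.Omega_Words_Fun"
    "HOL-Combinatorics.Permutations"
begin

datatype letter = La | Lb | Lc

text \<open>
  The factors of a word are its contiguous subwords, that is, \<^const>\<open>sublist\<close>
  (not \<^const>\<open>subseq\<close>).
\<close>

definition factorial_language :: "'a list set \<Rightarrow> bool" where
  "factorial_language L \<longleftrightarrow> (\<forall>w\<in>L. \<forall>u. sublist u w \<longrightarrow> u \<in> L)"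

definition extendable :: "'a list set \<Rightarrow> bool" where
  "extendable L \<longleftrightarrow> (\<forall>w\<in>L. (\<exists>y. y # w \<in> L) \<and> (\<exists>z. w @ [z] \<in> L))"

definition uniformly_recurrent :: "'a list set \<Rightarrow> bool" where
  "uniformly_recurrent L \<longleftrightarrow>
     (\<forall>w\<in>L. \<exists>K. \<forall>v\<in>L. K \<le> length v \<longrightarrow> sublist w v)"

definition right_special :: "'a list set \<Rightarrow> 'a list \<Rightarrow> bool" where
  "right_special L w \<longleftrightarrow> w \<in> L \<and> (\<exists>y z. y \<noteq> z \<and> w @ [y] \<in> L \<and> w @ [z] \<in> L)"

definition episturmian :: "'a list set \<Rightarrow> bool" where
  "episturmian L \<longleftrightarrow>
     factorial_language L \<and> extendable L \<and>
     uniformly_recurrent L \<and>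
     (\<forall>w\<in>L. rev w \<in> L) \<and>
     (\<forall>u v. right_special L u \<longrightarrow> right_special L v \<longrightarrow> length u = length v \<longrightarrow> u = v)"

text \<open>
  \<open>block x k z\<close> is the word traditionally written \<open>A\<^sub>k\<close>, \<open>B\<^sub>k\<close> or \<open>C\<^sub>k\<close>, according to
  whether \<open>z\<close> is \<open>a\<close>, \<open>b\<close> or \<open>c\<close>; \<open>x k\<close> is the rule applied at stage \<open>k\<close>.
  \<open>bispecial x k\<close> is the word traditionally written \<open>w\<^sub>k\<close>.
\<close>

fun block :: "(nat \<Rightarrow> 'a) \<Rightarrow> nat \<Rightarrow> 'a \<Rightarrow> 'a list" where
  "block x 0 z = [z]"
| "block x (Suc k) z = (if z = x k then block x k z else block x k z @ block x k (x k))"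

fun bispecial :: "(nat \<Rightarrow> 'a) \<Rightarrow> nat \<Rightarrow> 'a list" where
  "bispecial x 0 = []"
| "bispecial x (Suc k) = bispecial x k @ block x k (x k)"

definition language_of :: "(nat \<Rightarrow> 'a) \<Rightarrow> 'a list set" where
  "language_of x = {u. \<exists>k z. sublist u (block x k z)}"

definition directive_word :: "'a list set \<Rightarrow> (nat \<Rightarrow> 'a) \<Rightarrow> bool" where
  "directive_word L x \<longleftrightarrow> (\<forall>z. \<exists>k. x k = z) \<and> L = language_of x"

definition Rabc :: "(nat \<Rightarrow> letter) \<Rightarrow> bool" where
  "Rabc x \<longleftrightarrow> x 0 = La \<and> (\<exists>k. x k = Lb \<and> (\<forall>j<k. x j = La))"

text \<open>
  A total order \<open>a\<^sub>1 < \<dots> < a\<^sub>r\<close> on a finite alphabet is given by the list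
  \<open>[a\<^sub>1, \<dots>, a\<^sub>r]\<close> of all its letters. Words are compared through the lists of the ranks of
  their letters, which \<^theory>\<open>HOL-Library.List_Lexorder\<close> orders lexicographically.
\<close>

definition total_order_list :: "'a list \<Rightarrow> bool" where
  "total_order_list os \<longleftrightarrow> distinct os \<and> set os = UNIV"

definition letter_rank :: "'a list \<Rightarrow> 'a \<Rightarrow> nat" where
  "letter_rank os z = length (takeWhile (\<lambda>y. y \<noteq> z) os)"

definition conjugates :: "'a list \<Rightarrow> 'a list list" where
  "conjugates w = map (\<lambda>i. rotate i w) [0..<length w]"

definition burrows_wheeler :: "'a list \<Rightarrow> 'a list \<Rightarrow> 'a list" where
  "burrows_wheeler os w = map last (sort_key (map (letter_rank os)) (conjugates w))"

definition clusters_for :: "'a list \<Rightarrow> ('a \<Rightarrow> 'a) \<Rightarrow> 'a list \<Rightarrow> bool" where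
  "clusters_for os \<pi> w \<longleftrightarrow>
     burrows_wheeler os w = concat (map (\<lambda>z. replicate (count_list w (\<pi> z)) (\<pi> z)) os)"

definition clustering :: "'a list \<Rightarrow> bool" where
  "clustering w \<longleftrightarrow>
     (\<exists>os \<pi>. total_order_list os \<and> \<pi> permutes UNIV \<and> \<pi> \<noteq> id \<and> clusters_for os \<pi> w)"

definition directive_splits :: "(nat \<Rightarrow> letter) \<Rightarrow> bool" where
  "directive_splits x \<longleftrightarrow>
     (\<exists>D' D''. x = D' \<frown> D'' \<and> set D' \<subseteq> {La, Lb} \<and>
        (range D'' \<subseteq> {La, Lc} \<or> range D'' \<subseteq> {Lb, Lc}))"

definition first_c :: "(nat \<Rightarrow> letter) \<Rightarrow> nat" where
  "first_c x = (LEAST k. x k = Lc)"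

definition first_after_c :: "(nat \<Rightarrow> letter) \<Rightarrow> letter \<Rightarrow> nat" where
  "first_after_c x z = (LEAST k. first_c x < k \<and> x k = z)"

text \<open>
  The two stages above are least elements of nonempty sets whenever they are used.
\<close>

lemma first_stages_exist:
  assumes "\<forall>z. \<exists>k. x k = z" and "\<not> directive_splits x" and "z \<in> {La, Lb}"
  shows "x (first_c x) = Lc"
    and "first_c x < first_after_c x z \<and> x (first_after_c x z) = z"
proof -
  show c: "x (first_c x) = Lc"
    unfolding first_c_def using assms(1) by (metis (mono_tags, lifting) LeastI)
  have "\<exists>k. first_c x < k \<and> x k = z"
  proof (rule ccontr)
    assume "\<not> ?thesis"
    then have no: "x k \<noteq> z" if "first_c x \<le> k" for k
      using that assms(3) c by (cases "k = first_c x") auto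
    define D' where "D' = map x [0..<first_c x]"
    define D'' where "D'' = (\<lambda>n. x (first_c x + n))"
    have eq: "x = D' \<frown> D''"
      by (rule ext) (simp add: D'_def D''_def conc_def)
    have "x k \<noteq> Lc" if "k < first_c x" for k
      using not_less_Least that unfolding first_c_def by blast
    then have "set D' \<subseteq> {La, Lb}"
      unfolding D'_def by (auto, metis letter.exhaust)
    moreover have "range D'' \<subseteq> {La, Lc} \<or> range D'' \<subseteq> {Lb, Lc}"
    proof -
      have "D'' n \<noteq> z" for n
        unfolding D''_def using no by simp
      then show ?thesis
        using assms(3) by (auto, (metis letter.exhaust)+)
    qed
    ultimately show False
      using eq assms(2) unfolding directive_splits_def by blast
  qed
  then show "first_c x < first_after_c x z \<and> x (first_after_c x z) = z"
    unfolding first_after_c_def by (rule LeastI_ex)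
qed

end

theory Submission
  imports Defs
begin

text \<open>
  Write \<open>w\<^sub>k\<close> for \<open>bispecial x k\<close>. Clustering for an order \<open><\<close> and a permutation \<open>\<pi>\<close> means
  that, among the conjugates, larger ones end with letters that come no earlier in the order
  \<open>\<pi> a\<^sub>1, \<dots>, \<pi> a\<^sub>r\<close>. So if \<open>s u t\<close> and \<open>s' u t'\<close> are factors of a clustering word, with
  \<open>s \<noteq> s'\<close> and \<open>t < t'\<close>, then \<open>s\<close> precedes \<open>s'\<close> in the second order (\<open>clusters_for_order_condition\<close>).
  When \<open>e u s\<close>, \<open>e u t\<close> and \<open>t u e\<close> are all factors, this prevents \<open>e\<close> from lying
  strictly between \<open>t\<close> and \<open>s\<close>.

  If the directive word does not split, a long word contains such factors for each of the three
  letters \<open>e\<close>, with \<open>u = w\<^sub>k\<close> where \<open>k\<close> is the first stage of rule \<open>(e)\<close>; but in a total order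
  on three letters one of them lies in the middle. The factors come
  from \<open>bispecial_extensions\<close>: a letter whose rule is used after stage \<open>k\<close> and before stage
  \<open>m\<close> extends \<open>w\<^sub>k\<close>, on either side, opposite to \<open>x k\<close>, inside \<open>w\<^sub>m\<close>. The length bound comes
  from \<open>long_word_contains_factor\<close>: the language is cut into blocks of stage \<open>m\<close>, every cut is
  preceded by \<open>w\<^sub>m\<close>, so the occurrences of a factor of \<open>w\<^sub>m\<close> at a fixed offset before the cuts
  are separated by at most one block.

  If the directive word splits as \<open>D'\<close> on \<open>{p, q}\<close> followed by \<open>D''\<close> on \<open>{p, c}\<close>, the blocks of
  the letters \<open>p\<close> and \<open>c\<close> at every stage cluster for the order \<open>p < c < q\<close> and the permutation
  that reverses it. They arise from one letter by repeatedly inserting a letter \<open>e\<close> after each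
  other letter, and this operation preserves clustering for the reversal as long as \<open>e\<close> is the
  least or the greatest of the letters involved (\<open>perfectly_clustering_insert_extreme\<close>). While the
  rules of \<open>D''\<close> act, only \<open>p\<close> and \<open>c\<close> are present, so both are extreme; the rules of \<open>D'\<close>
  insert \<open>p\<close> or \<open>q\<close>, which are extreme among all three letters.
\<close>

section \<open>Block morphisms and bispecial words\<close>

definition expand :: "(nat \<Rightarrow> 'a) \<Rightarrow> nat \<Rightarrow> 'a list \<Rightarrow> 'a list" where
  "expand x m u = concat (map (block x m) u)"

lemma expand_simps [simp]:
  "expand x m [] = []"
  "expand x m (t # u) = block x m t @ expand x m u"
  "expand x m (u @ v) = expand x m u @ expand x m v"
  by (simp_all add: expand_def)

text \<open>
  The blocks of the directive word shifted by \<open>m\<close> describe how stage \<open>m + j\<close> blocks are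
  built from stage \<open>m\<close> blocks: the rules after stage \<open>m\<close> act on letters that stand for blocks.
\<close>

lemma block_add: "block x (m + j) z = expand x m (block (\<lambda>i. x (m + i)) j z)"
  by (induction j arbitrary: z) auto

lemma prefix_block_add: "Sublist.prefix (block x k z) (block x (j + k) z)"
  by (induction j) (auto intro: prefix_order.trans)

lemma length_block_le: "length (block x k z) \<le> 2 ^ k"
proof (induction k arbitrary: z)
  case (Suc k)
  show ?case using Suc[of z] Suc[of "x k"] by auto
qed simp

lemma block_starts_with_letter: "\<exists>u. block x k z = z # u"
  by (induction k) auto

lemma block_in_language: "block x k z \<in> language_of x"
  unfolding language_of_def by auto

lemma sublist_in_language: "v \<in> language_of x \<Longrightarrow> sublist u v \<Longrightarrow> u \<in> language_of x"
  unfolding language_of_def using sublist_order.order.trans by blast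

text \<open>
  Passing \<open>w\<^sub>k\<close> from one side of a block to the other reverses the block. This one identity
  yields both that \<open>w\<^sub>k\<close> is a palindrome and that \<open>w\<^sub>k\<close> reappears at the end of
  every concatenation of blocks that it precedes.
\<close>

lemma bispecial_block: "bispecial x k @ block x k z = rev (block x k z) @ bispecial x k"
proof (induction k arbitrary: z)
  case (Suc k)
  show ?case
    using Suc[of z] Suc[of "x k"] by simp (metis append.assoc)
qed simp

lemma bispecial_expand: "\<exists>q. bispecial x k @ expand x k u = q @ bispecial x k"
proof (induction u)
  case (Cons t u)
  then obtain q where "bispecial x k @ expand x k u = q @ bispecial x k" by blast
  then have "bispecial x k @ expand x k (t # u) = (rev (block x k t) @ q) @ bispecial x k"
    using bispecial_block[of x k t] by (metis append.assoc expand_simps(2))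
  then show ?case by blast
qed simp

lemma rev_bispecial: "rev (bispecial x k) = bispecial x k"
  by (induction k) (simp_all add: bispecial_block)

lemma prefix_bispecial: "j \<le> k \<Longrightarrow> Sublist.prefix (bispecial x j) (bispecial x k)"
  by (induction k rule: dec_induct) (auto intro: prefix_order.trans)

lemma suffix_bispecial:
  assumes "j \<le> k" shows "Sublist.suffix (bispecial x j) (bispecial x k)"
  using prefix_bispecial[OF assms, of x] by (simp add: suffix_to_prefix rev_bispecial)

text \<open>
  Since \<open>w\<^sub>j\<close> is a palindrome with prefix \<open>w\<^sub>k (x k)\<close>, it ends with \<open>(x k) w\<^sub>k\<close>, and the next
  letter in \<open>w\<^bsub>j+1\<^esub>\<close> is \<open>x j\<close>. The second factor is the mirror image of the first one.
\<close>

lemma bispecial_extensions: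
  assumes "k < j" "j < m"
  shows "sublist (x k # bispecial x k @ [x j]) (bispecial x m)"
    and "sublist (x j # bispecial x k @ [x k]) (bispecial x m)"
proof -
  obtain u where u: "block x k (x k) = x k # u" using block_starts_with_letter by metis
  obtain u' where u': "block x j (x j) = x j # u'" using block_starts_with_letter by metis
  have "bispecial x (Suc k) = rev u @ x k # bispecial x k"
    using bispecial_block[of x k "x k"] u by simp
  then have "Sublist.suffix (x k # bispecial x k) (bispecial x (Suc k))" by (simp add: Sublist.suffix_def)
  also have "Sublist.suffix (bispecial x (Suc k)) (bispecial x j)" using assms by (intro suffix_bispecial) simp
  finally obtain ps where "bispecial x j = ps @ x k # bispecial x k" by (auto simp: Sublist.suffix_def)
  then have "bispecial x (Suc j) = ps @ (x k # bispecial x k @ [x j]) @ u'"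
    using u' by simp
  then have "sublist (x k # bispecial x k @ [x j]) (bispecial x (Suc j))"
    by (metis sublist_appendI)
  also have "sublist (bispecial x (Suc j)) (bispecial x m)"
    using assms by (intro prefix_imp_sublist prefix_bispecial) simp
  finally show 1: "sublist (x k # bispecial x k @ [x j]) (bispecial x m)" .
  have "sublist (rev (x k # bispecial x k @ [x j])) (rev (bispecial x m))"
    using 1 by (simp only: sublist_rev)
  then show "sublist (x j # bispecial x k @ [x k]) (bispecial x m)"
    by (simp add: rev_bispecial)
qed

section \<open>Long words contain the short factors of a bispecial word\<close>

lemma extendable_far:
  assumes "extendable L" "v \<in> L"
  shows "\<exists>R T. length R = n \<and> length T = n \<and> R @ v @ T \<in> L"
proof (induction n)
  case 0
  then show ?case using assms(2) by simp
next
  case (Suc n)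
  then obtain R T where RT: "length R = n" "length T = n" "R @ v @ T \<in> L" by blast
  then obtain y where "y # R @ v @ T \<in> L" using assms(1) unfolding extendable_def by blast
  then obtain z where "(y # R @ v @ T) @ [z] \<in> L" using assms(1) unfolding extendable_def by blast
  then have "(y # R) @ v @ (T @ [z]) \<in> L" by simp
  then show ?case using RT by (metis length_Cons length_append_singleton)
qed

text \<open>
  The language can be desubstituted at any stage \<open>m\<close>: each of its words lies in
  a concatenation of blocks of that stage.
\<close>

lemma language_of_in_expansion:
  assumes "v \<in> language_of x"
  shows "\<exists>u. sublist v (expand x m u) \<and> expand x m u \<in> language_of x"
proof -
  obtain k z where "sublist v (block x k z)" using assms unfolding language_of_def by blast
  moreover have "sublist (block x k z) (block x (m + k) z)"
    by (intro prefix_imp_sublist prefix_block_add)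
  ultimately have "sublist v (block x (m + k) z)" by (rule sublist_order.order.trans)
  moreover have "block x (m + k) z \<in> language_of x" by (rule block_in_language)
  ultimately show ?thesis unfolding block_add by blast
qed

lemma bispecial_suffix_expand:
  assumes "length (bispecial x m) \<le> length (expand x m u)"
  shows "Sublist.suffix (bispecial x m) (expand x m u)"
proof (rule suffix_length_suffix)
  show "Sublist.suffix (bispecial x m) (bispecial x m @ expand x m u)"
    using bispecial_expand by (simp add: Sublist.suffix_def)
  show "Sublist.suffix (expand x m u) (bispecial x m @ expand x m u)" by (simp add: Sublist.suffix_def)
qed (fact assms)

text \<open>
  Extend \<open>v\<close> to \<open>R v T\<close> with long \<open>R\<close>, \<open>T\<close>, and cut \<open>R v T\<close> into blocks of stage \<open>m\<close>. Each cut
  that is not too far to the left is preceded by \<open>w\<^sub>m = s f s'\<close>, hence by an occurrence of \<open>f\<close>.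
  The first such occurrence that does not start inside \<open>R\<close> starts less than one block after the
  start of \<open>v\<close>, and that block is preceded by \<open>w\<^sub>m\<close>, so that its length is at most \<open>M\<close>.
\<close>

lemma long_word_contains_factor:
  assumes ext: "extendable (language_of x)" and v: "v \<in> language_of x"
    and f: "sublist f (bispecial x m)"
    and M: "\<And>t. bispecial x m @ block x m t \<in> language_of x \<Longrightarrow> length (block x m t) \<le> M"
    and len: "M + length f \<le> length v + 1"
  shows "sublist f v"
proof -
  let ?w = "bispecial x m"
  obtain s s' where w: "?w = s @ f @ s'" using f by (auto simp: sublist_def)
  obtain R0 T0 where RT0: "length R0 = length ?w + 2 ^ m" "length T0 = length ?w + 2 ^ m"
      "R0 @ v @ T0 \<in> language_of x"
    using extendable_far[OF ext v] by blast
  obtain u where u: "sublist (R0 @ v @ T0) (expand x m u)" "expand x m u \<in> language_of x"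
    using language_of_in_expansion[OF RT0(3)] by blast
  then obtain ps ss where "expand x m u = ps @ (R0 @ v @ T0) @ ss" by (auto simp: sublist_def)
  then obtain R T where eu: "expand x m u = R @ v @ T"
    and R: "length R \<ge> length ?w + 2 ^ m" and T: "length T \<ge> length ?w"
    using RT0 by (metis append.assoc le_add1 le_add2 length_append trans_le_add1)
  \<comment> \<open>\<open>b i\<close> is the position of the \<open>i\<close>-th cut; the copy of \<open>f\<close> before it ends at
      \<open>b i - |s'|\<close>.\<close>
  define b where "b i = length (expand x m (take i u))" for i
  define reached where "reached i \<longleftrightarrow> length R + length f + length s' \<le> b i" for i
  have "reached (length u)" unfolding reached_def b_def using eu T w by simp
  define i where "i = (LEAST i. reached i)"
  have ri: "reached i" unfolding i_def using \<open>reached (length u)\<close> by (rule LeastI)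
  have il: "i \<le> length u" unfolding i_def using \<open>reached (length u)\<close> by (rule Least_le)
  have "b 0 = 0" by (simp add: b_def)
  moreover have "length R > 0" using R zero_less_power[of "2::nat" m] by linarith
  ultimately have "\<not> reached 0" unfolding reached_def by linarith
  then obtain j where ij: "i = Suc j" using ri by (cases i) auto
  have "\<not> reached j" using not_less_Least[of j reached] ij unfolding i_def by simp
  define t where "t = u ! j"
  have take: "take i u = take j u @ [t]" using il ij t_def by (simp add: take_Suc_conv_app_nth)
  have bi: "b i = b j + length (block x m t)" unfolding b_def take by simp
  \<comment> \<open>The margin \<open>2 ^ m\<close> in \<open>R\<close> pays for one block, so that already the cut before the
      \<open>i\<close>-th one is preceded by \<open>w\<^sub>m\<close>.\<close>
  have "length ?w \<le> b j"
    using ri R bi length_block_le[of x m t] unfolding reached_def by linarith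
  then have suf_j: "Sublist.suffix ?w (expand x m (take j u))" unfolding b_def by (rule bispecial_suffix_expand)
  have pre: "Sublist.prefix (expand x m (take i u)) (expand x m u)"
    by (metis append_take_drop_id expand_simps(3) prefixI)
  have "Sublist.suffix (?w @ block x m t) (expand x m (take i u))"
    unfolding take using suf_j by (simp add: Sublist.suffix_def) 
  then have "sublist (?w @ block x m t) (expand x m u)"
    using pre by (meson prefix_imp_sublist sublist_order.order.trans suffix_imp_sublist)
  then have "length (block x m t) \<le> M" using M sublist_in_language u(2) by blast
  moreover have "b j < length R + length f + length s'"
    using \<open>\<not> reached j\<close> unfolding reached_def by simp
  ultimately have up: "b i \<le> length R + length v + length s'" using bi len by linarith
  have "length ?w \<le> b i" using \<open>length ?w \<le> b j\<close> bi by simp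
  then have "Sublist.suffix ?w (expand x m (take i u))" unfolding b_def by (rule bispecial_suffix_expand)
  then obtain \<alpha> where \<alpha>: "expand x m (take i u) = \<alpha> @ s @ f @ s'"
    unfolding w by (auto simp: Sublist.suffix_def)
  obtain \<beta> where \<beta>: "R @ v @ T = (\<alpha> @ s) @ f @ s' @ \<beta>"
    using pre eu \<alpha> by (auto simp: Sublist.prefix_def)
  have ls: "length \<alpha> + length s + length f + length s' = b i" unfolding b_def \<alpha> by simp
  then have "length R \<le> length (\<alpha> @ s)" using ri unfolding reached_def by simp
  then obtain \<gamma> where \<gamma>: "\<alpha> @ s = R @ \<gamma>" 
    using \<beta> by (metis prefixE prefixI prefix_length_prefix)
  then have eq: "v @ T = (\<gamma> @ f) @ s' @ \<beta>" using \<beta> by simp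
  have "length (\<gamma> @ f) \<le> length v" 
    using ls up arg_cong[OF \<gamma>, of length] by simp
  then have "Sublist.prefix (\<gamma> @ f) v" using eq by (metis prefixI prefix_length_prefix)
  then show ?thesis by (auto simp: Sublist.prefix_def sublist_def)
qed

section \<open>Clustering as a monotonicity property\<close>

lemma letter_rank_nth:
  assumes "distinct os" "i < length os" shows "letter_rank os (os ! i) = i"
proof -
  have "takeWhile (\<lambda>y. y \<noteq> os ! i) os = take i os"
    by (rule takeWhile_eq_take_P_nth) (use assms in \<open>auto simp: nth_eq_iff_index_eq\<close>)
  then show ?thesis using assms by (simp add: letter_rank_def)
qed

lemma map_letter_rank: "distinct os \<Longrightarrow> map (letter_rank os) os = [0..<length os]"
  by (rule nth_equalityI) (auto simp: letter_rank_nth)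

lemma inj_letter_rank: "total_order_list os \<Longrightarrow> inj (letter_rank os)"
  unfolding total_order_list_def 
  by (metis distinct_map distinct_upt map_letter_rank)

lemma map_last_conjugates:
  assumes "w \<noteq> []" shows "map last (conjugates w) = last w # butlast w"
proof (rule nth_equalityI)
  fix i assume "i < length (map last (conjugates w))"
  then have i: "i < length w" by (simp add: conjugates_def)
  show "map last (conjugates w) ! i = (last w # butlast w) ! i"
  proof (cases i)
    case (Suc j)
    then have "last (rotate i w) = last (take i w)" using i assms by (simp add: rotate_drop_take)
    also have "\<dots> = w ! j" using Suc i by (simp add: take_Suc_conv_app_nth)
    finally show ?thesis using Suc i by (simp add: conjugates_def nth_butlast)
  qed (use i in \<open>simp add: conjugates_def\<close>)
qed (use assms in \<open>simp add: conjugates_def\<close>)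

lemma mset_burrows_wheeler: "mset (burrows_wheeler os w) = mset w"
proof (cases "w = []")
  case False
  have "mset (burrows_wheeler os w) = mset (map last (conjugates w))"
    unfolding burrows_wheeler_def by simp
  also have "\<dots> = mset (butlast w @ [last w])" using map_last_conjugates[OF False] by simp
  finally show ?thesis using False by simp
qed (simp add: burrows_wheeler_def conjugates_def)

lemma sorted_concat_replicate: "sorted (concat (map (\<lambda>i. replicate (n i) i) [0..<l]))"
  for n :: "nat \<Rightarrow> nat"
  by (induction l) (auto simp: sorted_append)

lemma count_concat_replicate:
  assumes "distinct os" "inj \<pi>"
  shows "count (mset (concat (map (\<lambda>z. replicate (n (\<pi> z)) (\<pi> z)) os))) y =
    (if y \<in> \<pi> ` set os then n y else 0)"
  using assms by (induction os) (auto dest: injD)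

text \<open>
  The transform is a rearrangement of \<open>w\<close>, and the grouped word in the definition of clustering
  is the rearrangement of \<open>w\<close> that is sorted by the position of \<open>inv \<pi> z\<close> in the order;
  this key is injective, so there is only one.
\<close>

lemma clusters_for_iff_sorted:
  assumes os: "total_order_list os" and \<pi>: "\<pi> permutes UNIV"
  shows "clusters_for os \<pi> w \<longleftrightarrow> sorted (map (letter_rank os \<circ> inv \<pi>) (burrows_wheeler os w))"
proof -
  let ?g = "letter_rank os \<circ> inv \<pi>"
  let ?c = "concat (map (\<lambda>z. replicate (count_list w (\<pi> z)) (\<pi> z)) os)"
  have bij: "bij \<pi>" using \<pi> by (rule permutes_bij)
  then have "bij (inv \<pi>)" by (rule bij_imp_bij_inv)
  then have injg: "inj ?g" using inj_letter_rank[OF os] by (simp add: bij_is_inj inj_compose)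
  have d: "distinct os" and U: "set os = UNIV" using os by (auto simp: total_order_list_def)
  have "map ?g ?c = concat (map (\<lambda>z. replicate (count_list w (\<pi> z)) (letter_rank os z)) os)"
    using bij by (simp add: map_concat comp_def bij_is_inj inv_f_f)
  also have "\<dots> = concat (map (\<lambda>i. replicate (count_list w (\<pi> (os ! i))) i)
      (map (letter_rank os) os))"
    unfolding map_map comp_def
    by (intro arg_cong[where f = concat] map_cong refl)
      (metis d in_set_conv_nth letter_rank_nth)
  also have "sorted \<dots>" unfolding map_letter_rank[OF d] by (rule sorted_concat_replicate)
  finally have sc: "sorted (map ?g ?c)" .
  have "mset ?c = mset w"
  proof (rule multiset_eqI)
    fix y show "count (mset ?c) y = count (mset w) y"
      using count_concat_replicate[OF d bij_is_inj[OF bij], of "count_list w" y] bij U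
      by (simp add: count_mset bij_is_surj)
  qed
  then have m: "mset (map ?g ?c) = mset (map ?g (burrows_wheeler os w))"
    by (simp add: mset_burrows_wheeler)
  show ?thesis
  proof
    assume "clusters_for os \<pi> w"
    then show "sorted (map ?g (burrows_wheeler os w))" using sc by (simp add: clusters_for_def)
  next
    assume "sorted (map ?g (burrows_wheeler os w))"
    then have "map ?g (burrows_wheeler os w) = map ?g ?c"
      using sc m by (metis properties_for_sort)
    then show "clusters_for os \<pi> w"
      using injg unfolding clusters_for_def by (simp add: inj_map_eq_map)
  qed
qed

section \<open>Clustering words satisfy the order condition\<close>

lemma map_rank_less_iff:
  fixes f :: "'a \<Rightarrow> nat"
  assumes "inj f"
  shows "map f p < map f q \<longleftrightarrow> (p, q) \<in> lexord {(u, v). f u < f v}"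
proof (induction p arbitrary: q)
  case Nil
  show ?case by (cases q) auto
next
  case (Cons y p)
  show ?case using Cons injD[OF assms] by (cases q) auto
qed

text \<open>
  The conjugates that start with \<open>u t\<close> and with \<open>u t'\<close> and end with \<open>s\<close> and \<open>s'\<close> are
  compared by \<open>t\<close> and \<open>t'\<close>, and the transform lists their last letters in that order.
\<close>

lemma clusters_for_order_condition:
  assumes os: "total_order_list os" and \<pi>: "\<pi> permutes UNIV" and cl: "clusters_for os \<pi> v"
    and f: "sublist (s # u @ [t]) v" "sublist (s' # u @ [t']) v"
    and less: "letter_rank os t < letter_rank os t'"
  shows "letter_rank os (inv \<pi> s) \<le> letter_rank os (inv \<pi> s')"
proof -
  let ?K = "map (letter_rank os)"
  have rot: "\<exists>y. u @ t # y @ [s] \<in> set (conjugates v)" if sub: "sublist (s # u @ [t]) v" for s t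
  proof -
    obtain ps ss where v: "v = ps @ (s # u @ [t]) @ ss" using sub by (auto simp: sublist_def)
    then have "rotate (length (ps @ [s])) ((ps @ [s]) @ (u @ t # ss)) = u @ t # (ss @ ps) @ [s]"
      by (subst rotate_append) simp
    then have "rotate (Suc (length ps)) v = u @ t # (ss @ ps) @ [s]" using v by simp
    moreover have "Suc (length ps) < length v" using v by simp
    ultimately show ?thesis unfolding conjugates_def
      by (metis atLeastLessThan_iff image_eqI le0 list.set_map set_upt)
  qed
  obtain y where p: "u @ t # y @ [s] \<in> set (conjugates v)" (is "?p \<in> _") using rot f(1) by blast
  obtain y' where q: "u @ t' # y' @ [s'] \<in> set (conjugates v)" (is "?q \<in> _") using rot f(2) by blast
  define cs where "cs = sort_key ?K (conjugates v)"
  have "set cs = set (conjugates v)" by (simp add: cs_def)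
  then obtain i j where ij: "i < length cs" "cs ! i = ?p" "j < length cs" "cs ! j = ?q"
    using p q by (metis in_set_conv_nth)
  have "?K ?p < ?K ?q"
  proof -
    have "(?K ?p < ?K ?q) = (map (letter_rank os) (t # y @ [s]) < map (letter_rank os) (t' # y' @ [s']))"
      by (induction u) auto
    then show ?thesis using less by simp
  qed
  moreover have "sorted (map ?K cs)" by (simp add: cs_def)
  ultimately have "i < j"
    using ij sorted_nth_mono[of "map ?K cs" j i] by (metis leI leD length_map nth_map)
  have "sorted (map (letter_rank os \<circ> inv \<pi>) (map last cs))"
    using cl clusters_for_iff_sorted[OF os \<pi>] unfolding burrows_wheeler_def cs_def by blast
  then have "map (letter_rank os \<circ> inv \<pi>) (map last cs) ! i
      \<le> map (letter_rank os \<circ> inv \<pi>) (map last cs) ! j"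
    using \<open>i < j\<close> ij by (intro sorted_nth_mono) auto
  then show ?thesis using ij by simp
qed

section \<open>Perfectly clustering words\<close>

text \<open>
  This is clustering for the permutation that reverses the order, without
  the sorting: a smaller conjugate has a last letter at least as large. Taking the order as a
  relation lets an order and its converse be treated alike.
\<close>

definition perfectly_clustering :: "('a \<times> 'a) set \<Rightarrow> 'a list \<Rightarrow> bool" where
  "perfectly_clustering r w \<longleftrightarrow>
     (\<forall>i j. (rotate i w, rotate j w) \<in> lexord r \<longrightarrow>
        (last (rotate j w), last (rotate i w)) \<in> r\<^sup>=)"

text \<open>
  Rule \<open>(e)\<close> acts as the morphism \<open>insert_after e\<close>; its conjugate \<open>insert_before e\<close> is needed
  to describe the rotations that start at an inserted letter.
\<close>

definition insert_after :: "'a \<Rightarrow> 'a list \<Rightarrow> 'a list" where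
  "insert_after e w = concat (map (\<lambda>y. if y = e then [e] else [y, e]) w)"

definition insert_before :: "'a \<Rightarrow> 'a list \<Rightarrow> 'a list" where
  "insert_before e w = concat (map (\<lambda>y. if y = e then [e] else [e, y]) w)"

lemma insert_after_simps [simp]:
  "insert_after e [] = []"
  "insert_after e (y # w) = (if y = e then e # insert_after e w else y # e # insert_after e w)"
  "insert_after e (u @ v) = insert_after e u @ insert_after e v"
  by (simp_all add: insert_after_def)

lemma insert_before_simps [simp]:
  "insert_before e [] = []"
  "insert_before e (y # w) = (if y = e then e # insert_before e w else e # y # insert_before e w)"
  "insert_before e (u @ v) = insert_before e u @ insert_before e v"
  by (simp_all add: insert_before_def)

lemma insert_after_conv_before: "e # insert_after e w = insert_before e w @ [e]"
  by (induction w) auto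

lemma last_insert_after: "w \<noteq> [] \<Longrightarrow> last (insert_after e w) = e"
  by (induction w rule: rev_induct) auto

lemma last_insert_before: "w \<noteq> [] \<Longrightarrow> last (insert_before e w) = last w"
  by (induction w rule: rev_induct) auto

text \<open>
  A rotation of \<open>insert_after e w\<close> that starts with a letter different from \<open>e\<close> starts at the
  image of a letter of \<open>w\<close>. A rotation that starts with \<open>e\<close> can be read with each other letter
  preceded by its \<open>e\<close>, also when this first \<open>e\<close> is itself a letter of \<open>w\<close>. So the first
  letter decides between the two forms.
\<close>

lemma rotate_insert_after:
  assumes "w \<noteq> []"
  shows "\<exists>j. rotate i (insert_after e w) = insert_before e (rotate j w) \<or>
    rotate i (insert_after e w) = insert_after e (rotate j w) \<and> hd (rotate j w) \<noteq> e"
proof (induction i)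
  case 0
  obtain y w' where w: "w = y # w'" using assms by (cases w) auto
  show ?case
  proof (cases "y = e")
    case True
    then have "insert_after e w = insert_before e (rotate 1 w)"
      using w insert_after_conv_before[of e w'] by simp
    then show ?thesis by (metis rotate0 id_apply)
  next
    case False
    then have "insert_after e w = insert_after e (rotate 0 w) \<and> hd (rotate 0 w) \<noteq> e"
      using w by simp
    then show ?thesis by (metis rotate0 id_apply)
  qed
next
  case (Suc i)
  then obtain j where j: "rotate i (insert_after e w) = insert_before e (rotate j w) \<or>
    rotate i (insert_after e w) = insert_after e (rotate j w) \<and> hd (rotate j w) \<noteq> e" by blast
  obtain y r where r: "rotate j w = y # r" using assms by (cases "rotate j w") auto
  have r1: "rotate (Suc j) w = r @ [y]" using r by (simp)
  have *: "rotate (Suc i) (insert_after e w) = rotate1 (rotate i (insert_after e w))" by simp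
  from j show ?case
  proof (elim disjE conjE)
    assume a: "rotate i (insert_after e w) = insert_before e (rotate j w)"
    show ?thesis
    proof (cases "y = e")
      case True
      then have "rotate (Suc i) (insert_after e w) = insert_before e (rotate (Suc j) w)"
        unfolding * r1 a r by simp
      then show ?thesis by blast
    next
      case False
      then have "rotate (Suc i) (insert_after e w) = insert_after e (rotate j w)"
        unfolding * a r using insert_after_conv_before[of e r] by simp
      then show ?thesis using r False by (metis list.sel(1))
    qed
  next
    assume a: "rotate i (insert_after e w) = insert_after e (rotate j w)"
      and h: "hd (rotate j w) \<noteq> e"
    have "rotate (Suc i) (insert_after e w) = insert_before e (rotate (Suc j) w)"
      unfolding * r1 a r using h r insert_after_conv_before[of e r] by simp
    then show ?thesis by blast
  qed
qed

text \<open>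
  At the first place where \<open>p\<close> and \<open>q\<close> differ, if exactly one of them has \<open>e\<close>, then their images
  differ one letter later, where the image of the word that has \<open>e\<close> continues with the \<open>e\<close> of
  its next letter or ends. Either way it is the smaller image, and that word is the smaller
  word, because \<open>e\<close> is least.
\<close>

lemma lexord_insert_before:
  assumes "asym r" "\<And>y. y \<in> set p \<Longrightarrow> y \<noteq> e \<Longrightarrow> (e, y) \<in> r"
    "\<And>y. y \<in> set q \<Longrightarrow> y \<noteq> e \<Longrightarrow> (e, y) \<in> r"
    "(insert_before e p, insert_before e q) \<in> lexord r"
  shows "(p, q) \<in> lexord r"
  using assms(2-)
proof (induction p arbitrary: q)
  case Nil
  then show ?case by (cases q) auto
next
  case (Cons y p)
  then obtain y' q' where q: "q = y' # q'" by (cases q) (auto split: if_splits)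
  have irr: "(z, z) \<notin> r" for z using assms(1) by (meson asymD)
  consider "y = e" "y' = e" | "y = e" "y' \<noteq> e" | "y \<noteq> e" "y' = e" | "y \<noteq> e" "y' \<noteq> e" by blast
  then show ?case
  proof cases
    case 3
    then have "(y # insert_before e p, insert_before e q') \<in> lexord r"
      using Cons.prems q irr by simp
    then have "(y, e) \<in> r" using 3
      by (cases q') (auto split: if_splits)
    moreover have "(e, y) \<in> r" using Cons.prems(1)[of y] 3 by simp
    ultimately show ?thesis using assms(1) by (meson asymD)
  qed (use Cons q irr in \<open>auto\<close>)
qed

text \<open>
  Two rotations of the form \<open>insert_before\<close> compare and end as the rotations of \<open>w\<close> they come
  from. The rotations of the form \<open>insert_after\<close> do not start with the least letter \<open>e\<close>, so they
  are larger than all others, and they all end with \<open>e\<close>.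
\<close>

lemma perfectly_clustering_insert_min:
  assumes "asym r" "perfectly_clustering r w" "w \<noteq> []"
    and min: "\<And>y. y \<in> set w \<Longrightarrow> y \<noteq> e \<Longrightarrow> (e, y) \<in> r"
  shows "perfectly_clustering r (insert_after e w)"
  unfolding perfectly_clustering_def
proof (intro allI impI)
  fix i j
  let ?w = "insert_after e w"
  assume less: "(rotate i ?w, rotate j ?w) \<in> lexord r"
  obtain k where k: "rotate i ?w = insert_before e (rotate k w) \<or>
      rotate i ?w = insert_after e (rotate k w) \<and> hd (rotate k w) \<noteq> e"
    using rotate_insert_after[OF assms(3)] by blast
  obtain l where l: "rotate j ?w = insert_before e (rotate l w) \<or>
      rotate j ?w = insert_after e (rotate l w) \<and> hd (rotate l w) \<noteq> e"
    using rotate_insert_after[OF assms(3)] by blast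
  have ne: "rotate n w \<noteq> []" for n using assms(3) by simp
  from k show "(last (rotate j ?w), last (rotate i ?w)) \<in> r\<^sup>="
  proof (elim disjE conjE)
    assume a: "rotate i ?w = insert_before e (rotate k w)"
    from l show ?thesis
    proof (elim disjE conjE)
      assume b: "rotate j ?w = insert_before e (rotate l w)"
      have "(rotate k w, rotate l w) \<in> lexord r"
        by (rule lexord_insert_before[where e = e]) (use assms less a b in auto)
      then have "(last (rotate l w), last (rotate k w)) \<in> r\<^sup>="
        using assms(2) unfolding perfectly_clustering_def by blast
      then show ?thesis using ne by (simp add: a b last_insert_before)
    next
      assume b: "rotate j ?w = insert_after e (rotate l w)"
      have "last (rotate k w) \<in> set w" using last_in_set[OF ne] by simp
      then show ?thesis using min ne by (auto simp: a b last_insert_before last_insert_after)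
    qed
  next
    assume a: "rotate i ?w = insert_after e (rotate k w)" and h: "hd (rotate k w) \<noteq> e"
    from l show ?thesis
    proof (elim disjE conjE)
      assume b: "rotate j ?w = insert_before e (rotate l w)"
      obtain y p where yp: "rotate k w = y # p" using ne by (meson neq_Nil_conv)
      have "y \<in> set w" using yp by (metis list.set_intros(1) set_rotate)
      then have "(e, y) \<in> r" using min h yp by simp
      moreover have "(y, e) \<in> r"
        using less h ne[of l] unfolding a b yp by (cases "rotate l w") (auto split: if_splits)
      ultimately show ?thesis using assms(1) by (meson asymD)
    next
      assume b: "rotate j ?w = insert_after e (rotate l w)"
      show ?thesis using ne by (simp add: a b last_insert_after)
    qed
  qed
qed

lemma lexord_converse:
  "length p = length q \<Longrightarrow> (p, q) \<in> lexord (r\<inverse>) \<longleftrightarrow> (q, p) \<in> lexord r"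
  by (induction p q rule: list_induct2) auto

text \<open>
  Reversing the order exchanges smaller and larger both for conjugates and for last letters;
  conjugates have the same length, so that no proper prefix is involved.
\<close>

lemma perfectly_clustering_converse:
  "perfectly_clustering (r\<inverse>) w \<longleftrightarrow> perfectly_clustering r w"
  unfolding perfectly_clustering_def by (simp add: lexord_converse) (metis (no_types))

lemma perfectly_clustering_insert_extreme:
  assumes "asym r" "perfectly_clustering r w" "w \<noteq> []"
    and ext: "(\<forall>y\<in>set w. y \<noteq> e \<longrightarrow> (e, y) \<in> r) \<or> (\<forall>y\<in>set w. y \<noteq> e \<longrightarrow> (y, e) \<in> r)"
  shows "perfectly_clustering r (insert_after e w)"
  using ext
proof
  assume "\<forall>y\<in>set w. y \<noteq> e \<longrightarrow> (e, y) \<in> r"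
  then show ?thesis using perfectly_clustering_insert_min assms(1-3) by metis
next
  assume "\<forall>y\<in>set w. y \<noteq> e \<longrightarrow> (y, e) \<in> r"
  moreover have "asym (r\<inverse>)" using assms(1) by (meson asymI asymD converseD)
  ultimately have "perfectly_clustering (r\<inverse>) (insert_after e w)"
    using assms by (intro perfectly_clustering_insert_min) (auto simp: perfectly_clustering_converse)
  then show ?thesis by (simp add: perfectly_clustering_converse)
qed

lemma perfectly_clustering_imp_clusters_for:
  assumes os: "total_order_list os" and \<pi>: "\<pi> permutes UNIV"
    and rev: "\<And>y z. letter_rank os y < letter_rank os z \<Longrightarrow>
      letter_rank os (inv \<pi> z) \<le> letter_rank os (inv \<pi> y)"
    and pc: "perfectly_clustering {(y, z). letter_rank os y < letter_rank os z} w"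
  shows "clusters_for os \<pi> w"
proof -
  let ?K = "map (letter_rank os)"
  define cs where "cs = sort_key ?K (conjugates w)"
  have "sorted (map (letter_rank os \<circ> inv \<pi>) (map last cs))"
    unfolding sorted_iff_nth_mono_less
  proof (intro allI impI)
    fix i j assume ij: "i < j" and jl: "j < length (map (letter_rank os \<circ> inv \<pi>) (map last cs))"
    have "cs ! i \<in> set (conjugates w)" "cs ! j \<in> set (conjugates w)"
      using ij jl nth_mem[of i cs] nth_mem[of j cs] by (auto simp: cs_def)
    then obtain k l where kl: "cs ! i = rotate k w" "cs ! j = rotate l w"
      by (auto simp: conjugates_def)
    have "sorted (map ?K cs)" by (simp add: cs_def)
    then have "map ?K cs ! i \<le> map ?K cs ! j" using ij jl by (intro sorted_nth_mono) auto
    then have "?K (cs ! i) = ?K (cs ! j) \<or> ?K (cs ! i) < ?K (cs ! j)"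
      using ij jl by (auto simp: le_less)
    then have "last (cs ! i) = last (cs ! j)
        \<or> letter_rank os (last (cs ! j)) < letter_rank os (last (cs ! i))"
    proof
      assume "?K (cs ! i) = ?K (cs ! j)"
      then show ?thesis using inj_letter_rank[OF os] by (simp add: inj_map_eq_map)
    next
      assume "?K (cs ! i) < ?K (cs ! j)"
      then show ?thesis
        using pc unfolding map_rank_less_iff[OF inj_letter_rank[OF os]] perfectly_clustering_def kl
        by fastforce
    qed
    then have "letter_rank os (inv \<pi> (last (cs ! i))) \<le> letter_rank os (inv \<pi> (last (cs ! j)))"
      using rev by auto
    then show "map (letter_rank os \<circ> inv \<pi>) (map last cs) ! i
        \<le> map (letter_rank os \<circ> inv \<pi>) (map last cs) ! j"
      using ij jl by simp
  qed
  then show ?thesis unfolding clusters_for_iff_sorted[OF os \<pi>] burrows_wheeler_def cs_def .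
qed

section \<open>Directive words that split give infinitely many clustering words\<close>

text \<open>
  Peeling off the first rule, rather than the last one, exhibits a block as the image
  under a single insertion.
\<close>

lemma block_Suc_shift: "block x (Suc k) z = insert_after (x 0) (block (\<lambda>i. x (Suc i)) k z)"
proof -
  have "expand x (Suc 0) u = insert_after (x 0) u" for u by (induction u) auto
  then show ?thesis using block_add[of x "Suc 0" k z] by simp
qed

text \<open>
  Here \<open>c\<close> is the middle letter. It is inserted only by rules from stage \<open>n\<close> on, and these act on
  words without \<open>q\<close>, for which it is extreme. The clause for \<open>n = 0\<close> carries the absence
  of \<open>q\<close> through the induction, in which \<open>n\<close> decreases with each rule peeled off.
\<close>

lemma block_perfectly_clustering:
  assumes "asym r" and r: "(p, c) \<in> r" "(c, q) \<in> r" "(p, q) \<in> r" and U: "UNIV = {p, c, q}"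
    and x: "\<And>i. i < n \<Longrightarrow> x i \<in> {p, q}" "\<And>i. n \<le> i \<Longrightarrow> x i \<in> {p, c}"
    and z: "z \<in> {p, c}"
  shows "perfectly_clustering r (block x k z) \<and> (n = 0 \<longrightarrow> set (block x k z) \<subseteq> {p, c})"
  using x
proof (induction k arbitrary: x n)
  case 0
  have "rotate i [z] = [z]" for i by (induction i) auto
  then show ?case using z by (simp add: perfectly_clustering_def)
next
  case (Suc k)
  let ?b = "block (\<lambda>i. x (Suc i)) k z"
  have IH: "perfectly_clustering r ?b \<and> (n - 1 = 0 \<longrightarrow> set ?b \<subseteq> {p, c})"
    by (rule Suc.IH) (use Suc.prems in auto)
  have ne: "?b \<noteq> []" using block_starts_with_letter by (metis list.distinct(1))
  have ext: "(\<forall>y\<in>set ?b. y \<noteq> x 0 \<longrightarrow> (x 0, y) \<in> r) \<or> (\<forall>y\<in>set ?b. y \<noteq> x 0 \<longrightarrow> (y, x 0) \<in> r)"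
  proof -
    have y: "y \<in> {p, c, q}" for y using U by blast
    consider "x 0 = p" | "x 0 = q" | "n = 0" "x 0 = c" using Suc.prems[of 0] by (cases n) auto
    then show ?thesis
    proof cases
      case 1 then show ?thesis using y r by fastforce
    next
      case 2 then show ?thesis using y r by fastforce
    next
      case 3 then show ?thesis using IH r by fastforce
    qed
  qed
  have "perfectly_clustering r (block x (Suc k) z)"
    unfolding block_Suc_shift using assms(1) IH ne ext by (intro perfectly_clustering_insert_extreme) auto
  moreover have "set (block x (Suc k) z) \<subseteq> {p, c}" if "n = 0"
  proof -
    have "set (insert_after e u) \<subseteq> insert e (set u)" for e and u :: "'a list" by (induction u) auto
    moreover have "set ?b \<subseteq> {p, c}" using IH that by simp
    moreover have "x 0 \<in> {p, c}" using Suc.prems(2)[of 0] that by simp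
    ultimately show ?thesis unfolding block_Suc_shift by blast
  qed
  ultimately show ?case by blast
qed

text \<open>
  The sum is used because a single block may stop growing: if the rules are eventually all
  \<open>(p)\<close>, the block of \<open>p\<close> is eventually constant while that of \<open>c\<close> grows, and conversely.
\<close>

lemma block_lengths_unbounded:
  assumes "p \<noteq> c" "\<And>i. n \<le> i \<Longrightarrow> x i \<in> {p, c}"
  shows "k \<le> length (block x (n + k) p) + length (block x (n + k) c)"
proof (induction k)
  case (Suc k)
  have pos: "1 \<le> length (block x (n + k) t)" for t
    using block_starts_with_letter[of x "n + k" t] by auto
  have "x (n + k) = p \<or> x (n + k) = c" using assms(2)[of "n + k"] by auto
  then show ?case using Suc assms(1) pos[of p] pos[of c] by auto
qed simp

lemma infinite_clustering:
  fixes x :: "nat \<Rightarrow> letter"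
  assumes dist: "distinct [p, c, q]" and U: "UNIV = {p, c, q}"
    and x: "\<And>i. i < n \<Longrightarrow> x i \<in> {p, q}" "\<And>i. n \<le> i \<Longrightarrow> x i \<in> {p, c}"
  shows "infinite {v \<in> language_of x. clustering v}"
proof
  assume fin: "finite {v \<in> language_of x. clustering v}" (is "finite ?S")
  define os where "os = [p, c, q]"
  define \<pi> where "\<pi> = transpose p q"
  have os: "total_order_list os" using dist U by (auto simp: total_order_list_def os_def)
  have \<pi>: "\<pi> permutes UNIV" unfolding \<pi>_def by (rule permutes_swap_id) auto
  have \<pi>id: "\<pi> \<noteq> id" unfolding \<pi>_def using dist
    by (metis distinct_length_2_or_more id_apply transpose_apply_first)
  have rank: "letter_rank os p = 0" "letter_rank os c = 1" "letter_rank os q = 2"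
    using dist by (auto simp: letter_rank_def os_def)
  have tr: "\<pi> p = q" "\<pi> q = p" "\<pi> c = c" using dist by (auto simp: \<pi>_def)
  have inv: "inv \<pi> = \<pi>" by (simp add: \<pi>_def)
  have cases: "t = p \<or> t = c \<or> t = q" for t using U by blast
  have rev: "letter_rank os (inv \<pi> t) \<le> letter_rank os (inv \<pi> s)"
    if "letter_rank os s < letter_rank os t" for s t
    using cases[of s] cases[of t] that by (auto simp: inv tr rank)
  have mem: "block x k z \<in> ?S" if "z \<in> {p, c}" for k z
  proof -
    have "perfectly_clustering {(y, z). letter_rank os y < letter_rank os z} (block x k z)"
    proof -
      have "asym {(y, z). letter_rank os y < letter_rank os z}" by (auto intro: asymI)
      then show ?thesis
        using block_perfectly_clustering[OF _ _ _ _ U x that] by (simp add: rank)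
    qed
    then have "clusters_for os \<pi> (block x k z)"
      using perfectly_clustering_imp_clusters_for[OF os \<pi>] rev by blast
    then show ?thesis using os \<pi> \<pi>id block_in_language by (auto simp: clustering_def)
  qed
  have le: "length v \<le> Max (length ` ?S)" if "v \<in> ?S" for v using fin that by (intro Max_ge) auto
  define B where "B = Max (length ` ?S)"
  have "Suc (2 * B) \<le> length (block x (n + Suc (2 * B)) p) + length (block x (n + Suc (2 * B)) c)"
    by (rule block_lengths_unbounded) (use dist x(2) in auto)
  also have "\<dots> \<le> 2 * B"
    using le[OF mem, of p "n + Suc (2 * B)"] le[OF mem, of c "n + Suc (2 * B)"] unfolding B_def by simp
  finally show False by simp
qed

section \<open>The characterization\<close>

lemma UNIV_letter: "(UNIV :: letter set) = {La, Lb, Lc}"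
  using letter.exhaust by auto

text \<open>
  Each letter has a first stage \<open>k\<close> with its rule: \<open>0\<close> for \<open>a\<close>, \<open>p\<close> for \<open>b\<close> and \<open>first_c x\<close> for
  \<open>c\<close>. The rules of the two other letters occur between \<open>k\<close> and \<open>m\<close>; for \<open>b\<close> and \<open>c\<close> this
  uses that \<open>(a)\<close>, respectively \<open>(a)\<close> and \<open>(b)\<close>, recurs after the first \<open>(c)\<close>. Thus no letter can
  be the middle one.
\<close>

lemma no_long_clustering:
  fixes x :: "nat \<Rightarrow> letter"
  assumes ext: "extendable (language_of x)" and all: "\<forall>z. \<exists>k. x k = z" and R: "Rabc x"
    and ns: "\<not> directive_splits x"
    and yz: "{y, z} = {La, Lb}" "first_after_c x y < first_after_c x z"
    and m: "m = Suc (first_after_c x z)"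
    and v: "v \<in> language_of x"
    and len: "length (bispecial x (first_c x))
      + Max {length (block x m t) |t. bispecial x m @ block x m t \<in> language_of x} + 1 \<le> length v"
  shows "\<not> clustering v"
proof
  assume "clustering v"
  then obtain os \<pi> where os: "total_order_list os" and \<pi>: "\<pi> permutes UNIV"
    and cl: "clusters_for os \<pi> v" by (auto simp: clustering_def)
  let ?l = "first_c x"
  let ?S = "{length (block x m t) |t. bispecial x m @ block x m t \<in> language_of x}"
  have "?S \<subseteq> range (\<lambda>t. length (block x m t))" by auto
  moreover have "finite (range (\<lambda>t. length (block x m t)))" by (simp add: UNIV_letter)
  ultimately have fin: "finite ?S" by (rule finite_subset)
  have M: "length (block x m t) \<le> Max ?S" if "bispecial x m @ block x m t \<in> language_of x" for t
    using that fin by (intro Max_ge) auto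
  have short_factor: "sublist f v" if "sublist f (bispecial x m)" "length f \<le> length (bispecial x ?l) + 2" for f
    by (rule long_word_contains_factor[OF ext v that(1) M]) (use len that(2) in auto)
  have xl: "x ?l = Lc" using first_stages_exist(1)[OF all ns, of La] by simp
  have st: "?l < first_after_c x t \<and> x (first_after_c x t) = t \<and> first_after_c x t < m"
    if "t \<in> {La, Lb}" for t
  proof -
    have "t = y \<or> t = z" using that yz(1) by blast
    then show ?thesis using first_stages_exist(2)[OF all ns that] yz(2) m by auto
  qed
  obtain p where x0: "x 0 = La" and p: "x p = Lb" "\<forall>j<p. x j = La" using R by (auto simp: Rabc_def)
  have "p \<noteq> 0" using x0 p(1) by (cases p) auto
  have "p < ?l" using xl p by (metis letter.distinct(3,5) linorder_neqE_nat)
  have lm: "?l < m" using st[of La] by simp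
  have facts: "sublist (x k # bispecial x k @ [x j]) v" "sublist (x j # bispecial x k @ [x k]) v"
    if "k < j" "j < m" "k \<le> ?l" for k j
    using bispecial_extensions[OF that(1,2), of x] prefix_length_le[OF prefix_bispecial[OF that(3), of x]]
    by (auto intro!: short_factor)
  let ?f = "letter_rank os" and ?g = "\<lambda>t. letter_rank os (inv \<pi> t)"
  have oc: "?g s < ?g s'" if "?f t < ?f t'" "s \<noteq> s'"
      "sublist (s # bispecial x k @ [t]) v" "sublist (s' # bispecial x k @ [t']) v" for s s' t t' k
  proof -
    have "?g s \<le> ?g s'" using clusters_for_order_condition[OF os \<pi> cl that(3,4,1)] .
    moreover have "?g s \<noteq> ?g s'"
      using inj_letter_rank[OF os] permutes_inj[OF permutes_inv[OF \<pi>]] that(2) by (metis injD)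
    ultimately show ?thesis by simp
  qed
  have fne: "?f s \<noteq> ?f t" if "s \<noteq> t" for s t using inj_letter_rank[OF os] that by (metis injD)
  let ?a = "first_after_c x La" and ?b = "first_after_c x Lb"
  have a: "?l < ?a" "x ?a = La" "?a < m" and b: "?l < ?b" "x ?b = Lb" "?b < m"
    using st by auto
  have f0: "sublist (La # bispecial x 0 @ [Lb]) v" "sublist (Lb # bispecial x 0 @ [La]) v"
      "sublist (La # bispecial x 0 @ [Lc]) v" "sublist (Lc # bispecial x 0 @ [La]) v"
    using facts[of 0 p] facts[of 0 ?l] \<open>p \<noteq> 0\<close> \<open>p < ?l\<close> lm x0 p(1) xl by auto
  have fp: "sublist (Lb # bispecial x p @ [Lc]) v" "sublist (Lc # bispecial x p @ [Lb]) v"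
      "sublist (Lb # bispecial x p @ [La]) v" "sublist (La # bispecial x p @ [Lb]) v"
    using facts[of p ?l] facts[of p ?a] \<open>p < ?l\<close> lm a p(1) xl by auto
  have fl: "sublist (Lc # bispecial x ?l @ [La]) v" "sublist (La # bispecial x ?l @ [Lc]) v"
      "sublist (Lc # bispecial x ?l @ [Lb]) v" "sublist (Lb # bispecial x ?l @ [Lc]) v"
    using facts[of ?l ?a] facts[of ?l ?b] a b xl by auto
  have ne: "?f La \<noteq> ?f Lb" "?f La \<noteq> ?f Lc" "?f Lb \<noteq> ?f Lc" by (simp_all add: fne)
  \<comment> \<open>The first and second factor put \<open>t\<close> before \<open>e\<close> in the order of last letters; the third and
      the second one put \<open>e\<close> before \<open>t\<close>.\<close>
  have extreme: "\<not> (?f t < ?f e \<and> ?f e < ?f s)"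
    if "sublist (e # bispecial x k @ [s]) v" "sublist (t # bispecial x k @ [e]) v"
      "sublist (e # bispecial x k @ [t]) v" "e \<noteq> t" for e s t k
  proof
    assume "?f t < ?f e \<and> ?f e < ?f s"
    then have "?g t < ?g e" "?g e < ?g t"
      using oc[where s = t and s' = e and t = e and t' = s and k = k]
        oc[where s = e and s' = t and t = t and t' = e and k = k] that by auto
    then show False by simp
  qed
  show False
    using ne extreme[of La 0 Lb Lc] extreme[of La 0 Lc Lb] extreme[of Lb p La Lc]
      extreme[of Lb p Lc La] extreme[of Lc ?l La Lb] extreme[of Lc ?l Lb La] f0 fp fl
    by (simp del: bispecial.simps) linarith
qed

theorem theorem22:
  fixes \<Lambda> :: "letter list set" and x :: "nat \<Rightarrow> letter"
  assumes "episturmian \<Lambda>"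
    and "directive_word \<Lambda> x"
    and "Rabc x"
  shows "(infinite {v \<in> \<Lambda>. clustering v} \<longleftrightarrow> directive_splits x) \<and>
    (\<not> directive_splits x \<longrightarrow>
      (\<forall>y z. {y, z} = {La, Lb} \<and> first_after_c x y < first_after_c x z \<longrightarrow>
        (let m = Suc (first_after_c x z) in
          \<forall>v\<in>\<Lambda>.
            length v \<ge> length (bispecial x (first_c x))
              + Max {length (block x m t) |t. bispecial x m @ block x m t \<in> \<Lambda>} + 1
            \<longrightarrow> \<not> clustering v)))"
proof -
  have L: "\<Lambda> = language_of x" and all: "\<forall>z. \<exists>k. x k = z"
    using assms(2) by (auto simp: directive_word_def)
  have ext: "extendable (language_of x)" using assms(1) L by (simp add: episturmian_def)
  have bound: "\<not> clustering v"
    if "\<not> directive_splits x" "{y, z} = {La, Lb}" "first_after_c x y < first_after_c x z" 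
      "v \<in> \<Lambda>" "length v \<ge> length (bispecial x (first_c x))
        + Max {length (block x (Suc (first_after_c x z)) t) |t.
            bispecial x (Suc (first_after_c x z)) @ block x (Suc (first_after_c x z)) t \<in> \<Lambda>} + 1"
    for v y z
    using no_long_clustering[OF ext all assms(3) that(1-3) refl] that(4,5) unfolding L by blast
  \<comment> \<open>The two stages \<open>first_after_c x La\<close> and \<open>first_after_c x Lb\<close> carry different rules, so one
      comes first and the length bound applies to one of the two namings \<open>y\<close>, \<open>z\<close>.\<close>
  have "directive_splits x" if inf: "infinite {v \<in> \<Lambda>. clustering v}"
  proof (rule ccontr)
    assume ns: "\<not> directive_splits x"
    have "x (first_after_c x La) = La" "x (first_after_c x Lb) = Lb"
      using first_stages_exist(2)[OF all ns] by auto
    then have "first_after_c x La \<noteq> first_after_c x Lb" by auto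
    then obtain y z where yz: "{y, z} = {La, Lb}" "first_after_c x y < first_after_c x z"
      by (metis insert_commute linorder_neqE_nat)
    obtain N where N: "\<And>v. v \<in> \<Lambda> \<Longrightarrow> N \<le> length v \<Longrightarrow> \<not> clustering v"
      using bound[OF ns yz] by blast
    have "{v \<in> \<Lambda>. clustering v} \<subseteq> {v. set v \<subseteq> UNIV \<and> length v \<le> N}"
      using N nat_le_linear by auto
    moreover have "finite {v. set v \<subseteq> (UNIV :: letter set) \<and> length v \<le> N}"
      by (rule finite_lists_length_le) (simp add: UNIV_letter)
    ultimately show False using inf finite_subset by blast
  qed
  moreover have "infinite {v \<in> \<Lambda>. clustering v}" if splits: "directive_splits x"
  proof -
    obtain D' D'' where D: "x = D' \<frown> D''" "set D' \<subseteq> {La, Lb}"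
        "range D'' \<subseteq> {La, Lc} \<or> range D'' \<subseteq> {Lb, Lc}"
      using splits by (auto simp: directive_splits_def)
    have lo: "x i \<in> {La, Lb}" if "i < length D'" for i
      using that D(1,2) nth_mem by (auto simp: conc_def)
    have hi: "x i \<in> range D''" if "length D' \<le> i" for i
      using that D(1) by (simp add: conc_def)
    from D(3) show ?thesis
    proof
      assume ran: "range D'' \<subseteq> {La, Lc}"
      then have "infinite {v \<in> language_of x. clustering v}"
        using lo subsetD[OF ran hi]
        by (intro infinite_clustering[of La Lc Lb "length D'"]) (auto simp: UNIV_letter)
      then show ?thesis using L by simp
    next
      assume ran: "range D'' \<subseteq> {Lb, Lc}"
      then have "infinite {v \<in> language_of x. clustering v}"
        using lo subsetD[OF ran hi]
        by (intro infinite_clustering[of Lb Lc La "length D'"]) (auto simp: UNIV_letter)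
      then show ?thesis using L by simp
    qed
  qed
  ultimately show ?thesis using bound unfolding Let_def by blast
qed

end
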